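(* Every lextensive category satisfies Condition P.
   Context: A category $\mathbb{C}$ is extensive if it admits finite coproducts and for each pair of objects $A$, $B$ the coproduct functor $(\mathbb{C}\downarrow A)\times(\mathbb{C}\downarrow B)\to(\mathbb{C}\downarrow A+B)$, sending $((X,f),(Y,g))$ to $(X+Y,f+g)$ and $(u,v)$ to $u+v$, is an equivalence of categories. A category is lextensive if it is finitely complete and extensive. A feeble pullback in a category with finite limits is a commutative square such that the unique induced morphism from its initial corner into the pullback is a regular epimorphism. A category $\mathbb{C}$ with finite limits is said to satisfy Condition P if: (a) finite coproducts exist in $\mathbb{C}$; (b) binary coproducts of pullback squares are pullback squares in $\mathbb{C}$ (that is, given two pullback squares, the square obtained by taking the binary coproduct of corresponding objects and morphisms is a pullback); (c) for each monomorphism $m:S\to A$ in $\mathbb{C}$, the commutative square with top $m+1_S:S+S\to A+S$, left side $[1_S,1_S]:S+S\to S$, right side $[1_A,m]:A+S\to A$ and bottom $m:S\to A$ is a pullback; (d) for each regular epimorphism $p:E\to B$ in $\mathbb{C}$, the commutative square with top $p+p:E+E\to B+B$, left side $[1_E,1_E]:E+E\to E$, right side $[1_B,1_B]:B+B\to B$ and bottom $p:E\to B$ is a feeble pullback. *)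

theory Defs
  imports Main
begin

section \<open>Categories, functors, equivalences\<close>

text \<open>
  Objects and arrows form sets inside the types \<open>'o\<close> and \<open>'m\<close>; all operations are only
  meaningful on these carriers. \<open>g \<cdot>\<^bsub>C\<^esub> f\<close> is ``first \<open>f\<close>, then \<open>g\<close>''.
\<close>

record ('o, 'm) cat =
  Ob :: "'o set"
  Ar :: "'m set"
  Dom :: "'m \<Rightarrow> 'o"
  Cod :: "'m \<Rightarrow> 'o"
  Id :: "'o \<Rightarrow> 'm"
  Comp :: "'m \<Rightarrow> 'm \<Rightarrow> 'm" (infixl "\<cdot>\<index>" 70)

definition hom :: "('o, 'm) cat \<Rightarrow> 'o \<Rightarrow> 'o \<Rightarrow> 'm set" where
  "hom C A B = {f \<in> Ar C. Dom C f = A \<and> Cod C f = B}"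

locale category =
  fixes C :: "('o, 'm) cat" (structure)
  assumes dom_in_Ob: "f \<in> Ar C \<Longrightarrow> Dom C f \<in> Ob C"
    and cod_in_Ob: "f \<in> Ar C \<Longrightarrow> Cod C f \<in> Ob C"
    and Id_in_hom: "A \<in> Ob C \<Longrightarrow> Id C A \<in> hom C A A"
    and Comp_in_hom: "f \<in> hom C X Y \<Longrightarrow> g \<in> hom C Y Z \<Longrightarrow> g \<cdot> f \<in> hom C X Z"
    and Comp_Id: "f \<in> hom C X Y \<Longrightarrow> f \<cdot> Id C X = f"
    and Id_Comp: "f \<in> hom C X Y \<Longrightarrow> Id C Y \<cdot> f = f"
    and Comp_assoc: "f \<in> hom C W X \<Longrightarrow> g \<in> hom C X Y \<Longrightarrow> h \<in> hom C Y Z \<Longrightarrow>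
      (h \<cdot> g) \<cdot> f = h \<cdot> (g \<cdot> f)"

record ('o1, 'm1, 'o2, 'm2) funct =
  FOb :: "'o1 \<Rightarrow> 'o2"
  FAr :: "'m1 \<Rightarrow> 'm2"

definition is_functor ::
  "('o1, 'm1) cat \<Rightarrow> ('o2, 'm2) cat \<Rightarrow> ('o1, 'm1, 'o2, 'm2) funct \<Rightarrow> bool" where
  "is_functor C D F \<longleftrightarrow> category C \<and> category D \<and>
    (\<forall>X \<in> Ob C. FOb F X \<in> Ob D) \<and>
    (\<forall>X Y. \<forall>f \<in> hom C X Y. FAr F f \<in> hom D (FOb F X) (FOb F Y)) \<and>
    (\<forall>X \<in> Ob C. FAr F (Id C X) = Id D (FOb F X)) \<and>
    (\<forall>X Y Z. \<forall>f \<in> hom C X Y. \<forall>g \<in> hom C Y Z.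
      FAr F (g \<cdot>\<^bsub>C\<^esub> f) = FAr F g \<cdot>\<^bsub>D\<^esub> FAr F f)"

definition id_funct :: "('o, 'm, 'o, 'm) funct" where
  "id_funct = \<lparr>FOb = (\<lambda>X. X), FAr = (\<lambda>f. f)\<rparr>"

definition comp_funct :: "('o2, 'm2, 'o3, 'm3) funct \<Rightarrow> ('o1, 'm1, 'o2, 'm2) funct \<Rightarrow>
    ('o1, 'm1, 'o3, 'm3) funct" where
  "comp_funct G F = \<lparr>FOb = FOb G \<circ> FOb F, FAr = FAr G \<circ> FAr F\<rparr>"

definition is_iso :: "('o, 'm) cat \<Rightarrow> 'm \<Rightarrow> bool" where
  "is_iso C f \<longleftrightarrow> f \<in> Ar C \<and>
    (\<exists>g \<in> hom C (Cod C f) (Dom C f).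
      g \<cdot>\<^bsub>C\<^esub> f = Id C (Dom C f) \<and> f \<cdot>\<^bsub>C\<^esub> g = Id C (Cod C f))"

definition nat_trans :: "('o1, 'm1) cat \<Rightarrow> ('o2, 'm2) cat \<Rightarrow> ('o1, 'm1, 'o2, 'm2) funct \<Rightarrow>
    ('o1, 'm1, 'o2, 'm2) funct \<Rightarrow> ('o1 \<Rightarrow> 'm2) \<Rightarrow> bool" where
  "nat_trans C D F G \<tau> \<longleftrightarrow> is_functor C D F \<and> is_functor C D G \<and>
    (\<forall>X \<in> Ob C. \<tau> X \<in> hom D (FOb F X) (FOb G X)) \<and>
    (\<forall>X Y. \<forall>f \<in> hom C X Y. FAr G f \<cdot>\<^bsub>D\<^esub> \<tau> X = \<tau> Y \<cdot>\<^bsub>D\<^esub> FAr F f)"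

definition nat_isomorphic :: "('o1, 'm1) cat \<Rightarrow> ('o2, 'm2) cat \<Rightarrow>
    ('o1, 'm1, 'o2, 'm2) funct \<Rightarrow> ('o1, 'm1, 'o2, 'm2) funct \<Rightarrow> bool" where
  "nat_isomorphic C D F G \<longleftrightarrow> (\<exists>\<tau>. nat_trans C D F G \<tau> \<and> (\<forall>X \<in> Ob C. is_iso D (\<tau> X)))"

definition is_equivalence ::
  "('o1, 'm1) cat \<Rightarrow> ('o2, 'm2) cat \<Rightarrow> ('o1, 'm1, 'o2, 'm2) funct \<Rightarrow> bool" where
  "is_equivalence C D F \<longleftrightarrow> is_functor C D F \<and>
    (\<exists>G. is_functor D C G \<and>
      nat_isomorphic C C (comp_funct G F) id_funct \<and>
      nat_isomorphic D D (comp_funct F G) id_funct)"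

definition prod_cat ::
  "('o1, 'm1) cat \<Rightarrow> ('o2, 'm2) cat \<Rightarrow> ('o1 \<times> 'o2, 'm1 \<times> 'm2) cat" where
  "prod_cat C D =
    \<lparr>Ob = Ob C \<times> Ob D,
     Ar = Ar C \<times> Ar D,
     Dom = (\<lambda>(f, g). (Dom C f, Dom D g)),
     Cod = (\<lambda>(f, g). (Cod C f, Cod D g)),
     Id = (\<lambda>(X, Y). (Id C X, Id D Y)),
     Comp = (\<lambda>(f', g') (f, g). (f' \<cdot>\<^bsub>C\<^esub> f, g' \<cdot>\<^bsub>D\<^esub> g))\<rparr>"

text \<open>
  An arrow of the slice category carries its source and target, since the same \<open>u\<close> of \<open>C\<close>
  may underlie arrows between different objects over \<open>A\<close>.
\<close>

definition slice ::
  "('o, 'm) cat \<Rightarrow> 'o \<Rightarrow> ('o \<times> 'm, ('o \<times> 'm) \<times> 'm \<times> ('o \<times> 'm)) cat" where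
  "slice C A =
    \<lparr>Ob = {(X, f). f \<in> hom C X A},
     Ar = {((X, f), u, (Y, g)) | X f u Y g.
            f \<in> hom C X A \<and> g \<in> hom C Y A \<and> u \<in> hom C X Y \<and> g \<cdot>\<^bsub>C\<^esub> u = f},
     Dom = (\<lambda>(a, u, b). a),
     Cod = (\<lambda>(a, u, b). b),
     Id = (\<lambda>(X, f). ((X, f), Id C X, (X, f))),
     Comp = (\<lambda>(b', v, c) (a, u, b). (a, v \<cdot>\<^bsub>C\<^esub> u, c))\<rparr>"


section \<open>Finite limits\<close>

definition is_cone :: "('j, 'k) cat \<Rightarrow> ('o, 'm) cat \<Rightarrow> ('j, 'k, 'o, 'm) funct \<Rightarrow>
    'o \<Rightarrow> ('j \<Rightarrow> 'm) \<Rightarrow> bool" where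
  "is_cone J C D L \<pi> \<longleftrightarrow> L \<in> Ob C \<and>
    (\<forall>j \<in> Ob J. \<pi> j \<in> hom C L (FOb D j)) \<and>
    (\<forall>a \<in> Ar J. FAr D a \<cdot>\<^bsub>C\<^esub> \<pi> (Dom J a) = \<pi> (Cod J a))"

definition is_limit :: "('j, 'k) cat \<Rightarrow> ('o, 'm) cat \<Rightarrow> ('j, 'k, 'o, 'm) funct \<Rightarrow>
    'o \<Rightarrow> ('j \<Rightarrow> 'm) \<Rightarrow> bool" where
  "is_limit J C D L \<pi> \<longleftrightarrow> is_cone J C D L \<pi> \<and>
    (\<forall>M \<rho>. is_cone J C D M \<rho> \<longrightarrow>
      (\<exists>!u. u \<in> hom C M L \<and> (\<forall>j \<in> Ob J. \<pi> j \<cdot>\<^bsub>C\<^esub> u = \<rho> j)))"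

text \<open>
  Every finite category is isomorphic to one whose objects and arrows are natural numbers,
  so index categories of type \<open>(nat, nat) cat\<close> suffice.
\<close>

definition has_finite_limits :: "('o, 'm) cat \<Rightarrow> bool" where
  "has_finite_limits C \<longleftrightarrow>
    (\<forall>(J :: (nat, nat) cat) D. finite (Ob J) \<and> finite (Ar J) \<and> is_functor J C D \<longrightarrow>
      (\<exists>L \<pi>. is_limit J C D L \<pi>))"


section \<open>Finite coproducts\<close>

definition is_coproduct ::
  "('o, 'm) cat \<Rightarrow> 'i set \<Rightarrow> ('i \<Rightarrow> 'o) \<Rightarrow> 'o \<Rightarrow> ('i \<Rightarrow> 'm) \<Rightarrow> bool" where
  "is_coproduct C I A X \<iota> \<longleftrightarrow> X \<in> Ob C \<and> (\<forall>i \<in> I. \<iota> i \<in> hom C (A i) X) \<and>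
    (\<forall>Y \<in> Ob C. \<forall>f. (\<forall>i \<in> I. f i \<in> hom C (A i) Y) \<longrightarrow>
      (\<exists>!u. u \<in> hom C X Y \<and> (\<forall>i \<in> I. u \<cdot>\<^bsub>C\<^esub> \<iota> i = f i)))"

definition has_finite_coproducts :: "('o, 'm) cat \<Rightarrow> bool" where
  "has_finite_coproducts C \<longleftrightarrow>
    (\<forall>(n :: nat) A. (\<forall>i < n. A i \<in> Ob C) \<longrightarrow> (\<exists>X \<iota>. is_coproduct C {..<n} A X \<iota>))"

definition is_binary_coproduct :: "('o, 'm) cat \<Rightarrow> 'o \<Rightarrow> 'o \<Rightarrow> 'o \<Rightarrow> 'm \<Rightarrow> 'm \<Rightarrow> bool" where
  "is_binary_coproduct C A B X i j \<longleftrightarrow> i \<in> hom C A X \<and> j \<in> hom C B X \<and>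
    (\<forall>Y. \<forall>f \<in> hom C A Y. \<forall>g \<in> hom C B Y.
      \<exists>!u. u \<in> hom C X Y \<and> u \<cdot>\<^bsub>C\<^esub> i = f \<and> u \<cdot>\<^bsub>C\<^esub> j = g)"

text \<open>
  As usual, \<open>A + B\<close> refers to an arbitrary but fixed choice of binary coproducts. Another choice
  changes the constructions below only up to canonical isomorphism.
\<close>

definition chosen_coproduct :: "('o, 'm) cat \<Rightarrow> 'o \<Rightarrow> 'o \<Rightarrow> 'o \<times> 'm \<times> 'm" where
  "chosen_coproduct C A B = (SOME (X, i, j). is_binary_coproduct C A B X i j)"

definition sum_ob :: "('o, 'm) cat \<Rightarrow> 'o \<Rightarrow> 'o \<Rightarrow> 'o" where
  "sum_ob C A B = fst (chosen_coproduct C A B)"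

definition inl :: "('o, 'm) cat \<Rightarrow> 'o \<Rightarrow> 'o \<Rightarrow> 'm" where
  "inl C A B = fst (snd (chosen_coproduct C A B))"

definition inr :: "('o, 'm) cat \<Rightarrow> 'o \<Rightarrow> 'o \<Rightarrow> 'm" where
  "inr C A B = snd (snd (chosen_coproduct C A B))"

text \<open>\<open>copair C f g\<close> is the arrow \<open>[f, g]\<close>, and \<open>sum_ar C f g\<close> is \<open>f + g\<close>.\<close>

definition copair :: "('o, 'm) cat \<Rightarrow> 'm \<Rightarrow> 'm \<Rightarrow> 'm" where
  "copair C f g = (THE u. u \<in> hom C (sum_ob C (Dom C f) (Dom C g)) (Cod C f) \<and>
    u \<cdot>\<^bsub>C\<^esub> inl C (Dom C f) (Dom C g) = f \<and> u \<cdot>\<^bsub>C\<^esub> inr C (Dom C f) (Dom C g) = g)"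

definition sum_ar :: "('o, 'm) cat \<Rightarrow> 'm \<Rightarrow> 'm \<Rightarrow> 'm" where
  "sum_ar C f g = copair C
    (inl C (Cod C f) (Cod C g) \<cdot>\<^bsub>C\<^esub> f) (inr C (Cod C f) (Cod C g) \<cdot>\<^bsub>C\<^esub> g)"


section \<open>Extensive and lextensive categories\<close>

definition sum_slice_ob :: "('o, 'm) cat \<Rightarrow> ('o \<times> 'm) \<times> ('o \<times> 'm) \<Rightarrow> 'o \<times> 'm" where
  "sum_slice_ob C = (\<lambda>((X, f), (Y, g)). (sum_ob C X Y, sum_ar C f g))"

text \<open>The functor \<open>(C \<down> A) \<times> (C \<down> B) \<rightarrow> (C \<down> A + B)\<close>, given by the same formulas for all \<open>A\<close>, \<open>B\<close>.\<close>

definition coproduct_functor ::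
  "('o, 'm) cat \<Rightarrow>
    (('o \<times> 'm) \<times> ('o \<times> 'm),
     (('o \<times> 'm) \<times> 'm \<times> ('o \<times> 'm)) \<times> (('o \<times> 'm) \<times> 'm \<times> ('o \<times> 'm)),
     'o \<times> 'm,
     ('o \<times> 'm) \<times> 'm \<times> ('o \<times> 'm)) funct" where
  "coproduct_functor C =
    \<lparr>FOb = sum_slice_ob C,
     FAr = (\<lambda>((a, u, a'), (b, v, b')).
       (sum_slice_ob C (a, b), sum_ar C u v, sum_slice_ob C (a', b')))\<rparr>"

definition extensive :: "('o, 'm) cat \<Rightarrow> bool" where
  "extensive C \<longleftrightarrow> category C \<and> has_finite_coproducts C \<and>
    (\<forall>A \<in> Ob C. \<forall>B \<in> Ob C.
      is_equivalence (prod_cat (slice C A) (slice C B)) (slice C (sum_ob C A B))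
        (coproduct_functor C))"

definition lextensive :: "('o, 'm) cat \<Rightarrow> bool" where
  "lextensive C \<longleftrightarrow> has_finite_limits C \<and> extensive C"


section \<open>Pullbacks, feeble pullbacks, Condition P\<close>

text \<open>The arguments \<open>t\<close>, \<open>l\<close>, \<open>r\<close>, \<open>b\<close> are the top, left, right and bottom sides of a square.\<close>

definition comm_square :: "('o, 'm) cat \<Rightarrow> 'm \<Rightarrow> 'm \<Rightarrow> 'm \<Rightarrow> 'm \<Rightarrow> bool" where
  "comm_square C t l r b \<longleftrightarrow> t \<in> Ar C \<and> l \<in> Ar C \<and> r \<in> Ar C \<and> b \<in> Ar C \<and>
    Dom C t = Dom C l \<and> Cod C t = Dom C r \<and> Cod C l = Dom C b \<and> Cod C r = Cod C b \<and>
    r \<cdot>\<^bsub>C\<^esub> t = b \<cdot>\<^bsub>C\<^esub> l"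

definition pullback_square :: "('o, 'm) cat \<Rightarrow> 'm \<Rightarrow> 'm \<Rightarrow> 'm \<Rightarrow> 'm \<Rightarrow> bool" where
  "pullback_square C t l r b \<longleftrightarrow> comm_square C t l r b \<and>
    (\<forall>t' l'. comm_square C t' l' r b \<longrightarrow>
      (\<exists>!u. u \<in> hom C (Dom C t') (Dom C t) \<and> t \<cdot>\<^bsub>C\<^esub> u = t' \<and> l \<cdot>\<^bsub>C\<^esub> u = l'))"

definition mono_ar :: "('o, 'm) cat \<Rightarrow> 'm \<Rightarrow> bool" where
  "mono_ar C m \<longleftrightarrow> m \<in> Ar C \<and>
    (\<forall>X. \<forall>g \<in> hom C X (Dom C m). \<forall>h \<in> hom C X (Dom C m).
      m \<cdot>\<^bsub>C\<^esub> g = m \<cdot>\<^bsub>C\<^esub> h \<longrightarrow> g = h)"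

definition is_coequalizer :: "('o, 'm) cat \<Rightarrow> 'm \<Rightarrow> 'm \<Rightarrow> 'm \<Rightarrow> bool" where
  "is_coequalizer C f g p \<longleftrightarrow> (\<exists>D E B.
    f \<in> hom C D E \<and> g \<in> hom C D E \<and> p \<in> hom C E B \<and> p \<cdot>\<^bsub>C\<^esub> f = p \<cdot>\<^bsub>C\<^esub> g \<and>
    (\<forall>Y. \<forall>q \<in> hom C E Y. q \<cdot>\<^bsub>C\<^esub> f = q \<cdot>\<^bsub>C\<^esub> g \<longrightarrow>
      (\<exists>!u. u \<in> hom C B Y \<and> u \<cdot>\<^bsub>C\<^esub> p = q)))"

definition regular_epi :: "('o, 'm) cat \<Rightarrow> 'm \<Rightarrow> bool" where
  "regular_epi C p \<longleftrightarrow> (\<exists>f g. is_coequalizer C f g p)"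

text \<open>The square \<open>t'\<close>, \<open>l'\<close>, \<open>r\<close>, \<open>b\<close> is the pullback, and \<open>u\<close> is the induced arrow into it.\<close>

definition feeble_pullback_square :: "('o, 'm) cat \<Rightarrow> 'm \<Rightarrow> 'm \<Rightarrow> 'm \<Rightarrow> 'm \<Rightarrow> bool" where
  "feeble_pullback_square C t l r b \<longleftrightarrow> comm_square C t l r b \<and>
    (\<exists>t' l' u. pullback_square C t' l' r b \<and>
      u \<in> hom C (Dom C t) (Dom C t') \<and> t' \<cdot>\<^bsub>C\<^esub> u = t \<and> l' \<cdot>\<^bsub>C\<^esub> u = l \<and>
      regular_epi C u)"

definition condition_P :: "('o, 'm) cat \<Rightarrow> bool" where
  "condition_P C \<longleftrightarrow> category C \<and> has_finite_limits C \<and>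
    has_finite_coproducts C \<and>
    (\<forall>t l r b t' l' r' b'. pullback_square C t l r b \<and> pullback_square C t' l' r' b' \<longrightarrow>
      pullback_square C (sum_ar C t t') (sum_ar C l l') (sum_ar C r r') (sum_ar C b b')) \<and>
    (\<forall>S A. \<forall>m \<in> hom C S A. mono_ar C m \<longrightarrow>
      pullback_square C (sum_ar C m (Id C S)) (copair C (Id C S) (Id C S))
        (copair C (Id C A) m) m) \<and>
    (\<forall>E B. \<forall>p \<in> hom C E B. regular_epi C p \<longrightarrow>
      feeble_pullback_square C (sum_ar C p p) (copair C (Id C E) (Id C E))
        (copair C (Id C B) (Id C B)) p)"

end

theory Submission
  imports Defs
begin

text \<open>
  Over an extensive category every arrow \<open>W \<rightarrow> A + B\<close> splits, up to an isomorphism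
  \<open>W \<cong> W\<^sub>1 + W\<^sub>2\<close>, as a sum of arrows, and arrows of sums over \<open>A + B\<close> are uniquely sums of arrows
  over \<open>A\<close> and \<open>B\<close>. A cone over a sum of squares can therefore be treated summand by summand, which
  gives (b). In the same way two pullbacks with a common bottom side glue along copairing. Gluing the
  pullback of \<open>m\<close> along an identity with the kernel pair of the monomorphism \<open>m\<close> gives (c); gluing the
  pullback of \<open>p\<close> along an identity with itself shows that the square in (d) is a genuine pullback.
\<close>

section \<open>Equivalences are full and faithful\<close>

lemma is_equivalenceE:
  assumes "is_equivalence C D F"
  obtains G \<sigma> \<tau> where "is_functor C D F" "is_functor D C G"
    "nat_trans C C (comp_funct G F) id_funct \<sigma>" "\<And>X. X \<in> Ob C \<Longrightarrow> is_iso C (\<sigma> X)"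
    "nat_trans D D (comp_funct F G) id_funct \<tau>" "\<And>X. X \<in> Ob D \<Longrightarrow> is_iso D (\<tau> X)"
  using assms unfolding is_equivalence_def nat_isomorphic_def by blast

section \<open>Inverses and cancellation of isomorphisms\<close>

context category
begin

lemma hom_Ob:
  assumes "f \<in> hom C X Y"
  shows "X \<in> Ob C" "Y \<in> Ob C"
  using assms dom_in_Ob cod_in_Ob by (auto simp: hom_def)

lemma is_isoE:
  assumes "is_iso C f" "f \<in> hom C X Y"
  obtains g where "g \<in> hom C Y X" "g \<cdot> f = Id C X" "f \<cdot> g = Id C Y"
  using assms unfolding is_iso_def hom_def by auto

lemma iso_cancel_right:
  assumes "is_iso C e" "e \<in> hom C X Y" "f \<in> hom C Y Z" "g \<in> hom C Y Z" "f \<cdot> e = g \<cdot> e"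
  shows "f = g"
proof -
  obtain d where d: "d \<in> hom C Y X" "e \<cdot> d = Id C Y"
    by (rule is_isoE[OF assms(1,2)])
  have "(h \<cdot> e) \<cdot> d = h" if "h \<in> hom C Y Z" for h
    using Comp_assoc[OF d(1) assms(2) that] Comp_Id[OF that] d(2) by simp
  from this[OF assms(3)] this[OF assms(4)] show ?thesis using assms(5) by metis
qed

lemma iso_cancel_left:
  assumes "is_iso C e" "e \<in> hom C Y Z" "f \<in> hom C X Y" "g \<in> hom C X Y" "e \<cdot> f = e \<cdot> g"
  shows "f = g"
proof -
  obtain d where d: "d \<in> hom C Z Y" "d \<cdot> e = Id C Y"
    by (rule is_isoE[OF assms(1,2)])
  have "d \<cdot> (e \<cdot> h) = h" if "h \<in> hom C X Y" for h
    using Comp_assoc[OF that assms(2) d(1)] Id_Comp[OF that] d(2) by simp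
  from this[OF assms(3)] this[OF assms(4)] show ?thesis using assms(5) by metis
qed

end

section \<open>Faithfulness, fullness and essential surjectivity of equivalences\<close>

lemma is_functor_hom:
  "is_functor C D F \<Longrightarrow> f \<in> hom C X Y \<Longrightarrow> FAr F f \<in> hom D (FOb F X) (FOb F Y)"
  unfolding is_functor_def by blast

text \<open>By naturality \<open>h \<cdot> \<sigma> X\<close> depends on \<open>h\<close> only
  through \<open>FAr F h\<close>, and the isomorphism \<open>\<sigma> X\<close> can be cancelled.
  Only one of the two natural isomorphisms of an equivalence appears, so the lemma serves for
  \<open>F\<close> and, with the roles exchanged, for its quasi-inverse.\<close>

lemma faithful_if_left_inverse:
  assumes F: "is_functor C D F"
    and \<sigma>: "nat_trans C C (comp_funct G F) id_funct \<sigma>" and iso: "\<And>X. X \<in> Ob C \<Longrightarrow> is_iso C (\<sigma> X)"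
    and f: "f \<in> hom C X Y" and g: "g \<in> hom C X Y" and eq: "FAr F f = FAr F g"
  shows "f = g"
proof -
  interpret category C using F by (simp add: is_functor_def)
  have X: "X \<in> Ob C" using hom_Ob f by blast
  have \<sigma>X: "\<sigma> X \<in> hom C (FOb G (FOb F X)) X"
    using \<sigma> X by (auto simp: nat_trans_def comp_funct_def id_funct_def)
  have "h \<cdot>\<^bsub>C\<^esub> \<sigma> X = \<sigma> Y \<cdot>\<^bsub>C\<^esub> FAr G (FAr F h)" if "h \<in> hom C X Y" for h
    using \<sigma> that by (auto simp: nat_trans_def comp_funct_def id_funct_def)
  then have "f \<cdot>\<^bsub>C\<^esub> \<sigma> X = g \<cdot>\<^bsub>C\<^esub> \<sigma> X" using f g eq by simp
  then show ?thesis using iso_cancel_right[OF iso[OF X] \<sigma>X f g] by simp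
qed

lemma equivalence_faithful:
  assumes "is_equivalence C D F" "f \<in> hom C X Y" "g \<in> hom C X Y" "FAr F f = FAr F g"
  shows "f = g"
  using assms(1)
proof (rule is_equivalenceE)
  fix G \<sigma> \<tau>
  assume "is_functor C D F" "nat_trans C C (comp_funct G F) id_funct \<sigma>"
    "\<And>X. X \<in> Ob C \<Longrightarrow> is_iso C (\<sigma> X)"
  from faithful_if_left_inverse[OF this assms(2-)] show ?thesis .
qed

text \<open>The quasi-inverse \<open>G\<close> sends \<open>v\<close> to an arrow that becomes a
  candidate preimage \<open>u\<close> after conjugation by \<open>\<sigma>\<close>. Naturality shows
  that \<open>FAr F u\<close> and \<open>v\<close> have the same image under \<open>G\<close>, and
  \<open>G\<close> is faithful.\<close>

lemma equivalence_full:
  assumes "is_equivalence C D F" and X: "X \<in> Ob C" and Y: "Y \<in> Ob C"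
    and v: "v \<in> hom D (FOb F X) (FOb F Y)"
  shows "\<exists>u \<in> hom C X Y. FAr F u = v"
  using assms(1)
proof (rule is_equivalenceE)
  fix G \<sigma> \<tau>
  assume F: "is_functor C D F" and G: "is_functor D C G"
    and \<sigma>: "nat_trans C C (comp_funct G F) id_funct \<sigma>"
    and \<sigma>_iso: "\<And>X. X \<in> Ob C \<Longrightarrow> is_iso C (\<sigma> X)"
    and \<tau>: "nat_trans D D (comp_funct F G) id_funct \<tau>"
    and \<tau>_iso: "\<And>X. X \<in> Ob D \<Longrightarrow> is_iso D (\<tau> X)"
  interpret category C using F by (simp add: is_functor_def)
  have \<sigma>_hom: "\<sigma> Z \<in> hom C (FOb G (FOb F Z)) Z" if "Z \<in> Ob C" for Z
    using \<sigma> that by (auto simp: nat_trans_def comp_funct_def id_funct_def)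
  obtain s where s: "s \<in> hom C X (FOb G (FOb F X))" "s \<cdot>\<^bsub>C\<^esub> \<sigma> X = Id C (FOb G (FOb F X))"
    using is_isoE[OF \<sigma>_iso[OF X] \<sigma>_hom[OF X]] by blast
  have Gv: "FAr G v \<in> hom C (FOb G (FOb F X)) (FOb G (FOb F Y))"
    using is_functor_hom[OF G v] .
  \<comment> \<open>Here \<open>s\<close> is the inverse of \<open>\<sigma> X\<close>, so
    \<open>u\<close> is \<open>FAr G v\<close> conjugated by \<open>\<sigma>\<close>.\<close>
  define u where "u = \<sigma> Y \<cdot>\<^bsub>C\<^esub> (FAr G v \<cdot>\<^bsub>C\<^esub> s)"
  have u: "u \<in> hom C X Y"
    unfolding u_def using Comp_in_hom s(1) Gv \<sigma>_hom[OF Y] by blast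
  have "\<sigma> Y \<cdot>\<^bsub>C\<^esub> FAr G (FAr F u) = u \<cdot>\<^bsub>C\<^esub> \<sigma> X"
    using \<sigma> u by (auto simp: nat_trans_def comp_funct_def id_funct_def)
  also have "\<dots> = \<sigma> Y \<cdot>\<^bsub>C\<^esub> ((FAr G v \<cdot>\<^bsub>C\<^esub> s) \<cdot>\<^bsub>C\<^esub> \<sigma> X)"
    unfolding u_def using Comp_assoc Comp_in_hom s(1) Gv \<sigma>_hom X Y by blast
  also have "(FAr G v \<cdot>\<^bsub>C\<^esub> s) \<cdot>\<^bsub>C\<^esub> \<sigma> X = FAr G v"
    using Comp_assoc[OF \<sigma>_hom[OF X] s(1) Gv] s(2) Comp_Id[OF Gv] by simp
  finally have "FAr G (FAr F u) = FAr G v"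
    by (rule iso_cancel_left[OF \<sigma>_iso[OF Y] \<sigma>_hom[OF Y]
        is_functor_hom[OF G is_functor_hom[OF F u]] Gv])
  \<comment> \<open>Faithfulness of \<open>G\<close>: \<open>\<tau>\<close> exhibits
    \<open>F\<close> as its inverse on one side.\<close>
  from faithful_if_left_inverse[OF G \<tau> \<tau>_iso is_functor_hom[OF F u] v this]
  show ?thesis using u by blast
qed

text \<open>The object is \<open>FOb G Y\<close>, and the isomorphism is the component of
  \<open>\<tau>\<close> at \<open>Y\<close>.\<close>

lemma equivalence_essentially_surjective:
  assumes "is_equivalence C D F" "Y \<in> Ob D"
  shows "\<exists>X \<in> Ob C. \<exists>e \<in> hom D (FOb F X) Y. is_iso D e"
  using assms(1)
proof (rule is_equivalenceE)
  fix G \<sigma> \<tau>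
  assume G: "is_functor D C G" and \<tau>: "nat_trans D D (comp_funct F G) id_funct \<tau>"
    and iso: "\<And>X. X \<in> Ob D \<Longrightarrow> is_iso D (\<tau> X)"
  have "FOb G Y \<in> Ob C" using G assms(2) by (auto simp: is_functor_def)
  moreover have "\<tau> Y \<in> hom D (FOb F (FOb G Y)) Y"
    using \<tau> assms(2) by (auto simp: nat_trans_def comp_funct_def id_funct_def)
  ultimately show ?thesis using iso[OF assms(2)] by blast
qed

section \<open>Sums of objects and arrows\<close>

locale category_with_sums = category +
  assumes finite_coproducts: "has_finite_coproducts C"
begin

lemma binary_coproduct_exists:
  assumes A: "A \<in> Ob C" and B: "B \<in> Ob C"
  shows "\<exists>X i j. is_binary_coproduct C A B X i j"
proof -
  \<comment> \<open>The pair is encoded as a family on all naturals; only the indices 0 and 1 lie in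
    \<open>{..<2}\<close>. The family \<open>fg\<close> below follows the same pattern.\<close>
  define AB where "AB = (\<lambda>n::nat. if n = 0 then A else B)"
  have two: "(\<forall>n \<in> {..<2::nat}. P n) \<longleftrightarrow> P 0 \<and> P 1" for P
    by (auto simp: less_2_cases_iff)
  have "\<forall>n < 2. AB n \<in> Ob C" using A B by (simp add: AB_def)
  then obtain X \<iota> where X: "is_coproduct C {..<2} AB X \<iota>"
    using finite_coproducts unfolding has_finite_coproducts_def by blast
  have "\<exists>!u. u \<in> hom C X Y \<and> u \<cdot> \<iota> 0 = f \<and> u \<cdot> \<iota> 1 = g"
    if "f \<in> hom C A Y" "g \<in> hom C B Y" for Y f g
  proof -
    define fg where "fg = (\<lambda>n::nat. if n = 0 then f else g)"
    have "\<forall>n \<in> {..<2}. fg n \<in> hom C (AB n) Y" using that by (auto simp: fg_def AB_def)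
    then have "\<exists>!u. u \<in> hom C X Y \<and> (\<forall>n \<in> {..<2}. u \<cdot> \<iota> n = fg n)"
      using X hom_Ob(2)[OF that(1)] unfolding is_coproduct_def by blast
    then show ?thesis unfolding two by (simp add: fg_def)
  qed
  moreover have "\<iota> 0 \<in> hom C A X" "\<iota> 1 \<in> hom C B X"
    using X unfolding is_coproduct_def two AB_def by auto
  ultimately have "is_binary_coproduct C A B X (\<iota> 0) (\<iota> 1)"
    unfolding is_binary_coproduct_def by blast
  then show ?thesis by blast
qed

lemma sum_is_binary_coproduct:
  assumes "A \<in> Ob C" "B \<in> Ob C"
  shows "is_binary_coproduct C A B (sum_ob C A B) (inl C A B) (inr C A B)"
proof -
  obtain X i j where "is_binary_coproduct C A B X i j"
    using binary_coproduct_exists[OF assms] by blast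
  then have "case chosen_coproduct C A B of (X, i, j) \<Rightarrow> is_binary_coproduct C A B X i j"
    unfolding chosen_coproduct_def
    by (intro someI[where x = "(X, i, j)" and P = "\<lambda>(X, i, j). is_binary_coproduct C A B X i j"]) simp
  then show ?thesis by (simp add: sum_ob_def inl_def inr_def split: prod.splits)
qed

lemma inl_in_hom: "A \<in> Ob C \<Longrightarrow> B \<in> Ob C \<Longrightarrow> inl C A B \<in> hom C A (sum_ob C A B)"
  and inr_in_hom: "A \<in> Ob C \<Longrightarrow> B \<in> Ob C \<Longrightarrow> inr C A B \<in> hom C B (sum_ob C A B)"
  using sum_is_binary_coproduct by (simp_all add: is_binary_coproduct_def)

text \<open>The definition of \<open>copair\<close> reads the corners off \<open>Dom\<close> and
  \<open>Cod\<close>. For arrows in the given hom-sets these are \<open>A\<close>, \<open>B\<close>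
  and \<open>Y\<close>, and the definite description then denotes the unique mediating
  arrow.\<close>

lemma copair_spec:
  assumes f: "f \<in> hom C A Y" and g: "g \<in> hom C B Y"
  shows "copair C f g \<in> hom C (sum_ob C A B) Y \<and>
    copair C f g \<cdot> inl C A B = f \<and> copair C f g \<cdot> inr C A B = g"
proof -
  have "\<exists>!u. u \<in> hom C (sum_ob C A B) Y \<and> u \<cdot> inl C A B = f \<and> u \<cdot> inr C A B = g"
    using sum_is_binary_coproduct[OF hom_Ob(1)[OF f] hom_Ob(1)[OF g]] f g
    unfolding is_binary_coproduct_def by blast
  moreover have "Dom C f = A" "Cod C f = Y" "Dom C g = B" using f g by (auto simp: hom_def)
  ultimately show ?thesis unfolding copair_def by (simp only:) (rule theI')
qed

lemma copair_in_hom: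
    "f \<in> hom C A Y \<Longrightarrow> g \<in> hom C B Y \<Longrightarrow> copair C f g \<in> hom C (sum_ob C A B) Y"
  and copair_inl: "f \<in> hom C A Y \<Longrightarrow> g \<in> hom C B Y \<Longrightarrow> copair C f g \<cdot> inl C A B = f"
  and copair_inr: "f \<in> hom C A Y \<Longrightarrow> g \<in> hom C B Y \<Longrightarrow> copair C f g \<cdot> inr C A B = g"
  using copair_spec by blast+

text \<open>Both sides agree on the two injections, so uniqueness of the mediating arrow applies.
  This is how equations between arrows out of a sum are proved below.\<close>

lemma copair_unique:
  assumes u: "u \<in> hom C (sum_ob C A B) Y" and A: "A \<in> Ob C" and B: "B \<in> Ob C"
  shows "u = copair C (u \<cdot> inl C A B) (u \<cdot> inr C A B)"
proof -
  have f: "u \<cdot> inl C A B \<in> hom C A Y" and g: "u \<cdot> inr C A B \<in> hom C B Y"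
    using Comp_in_hom[OF inl_in_hom[OF A B] u] Comp_in_hom[OF inr_in_hom[OF A B] u] .
  then have "\<exists>!v. v \<in> hom C (sum_ob C A B) Y \<and>
      v \<cdot> inl C A B = u \<cdot> inl C A B \<and> v \<cdot> inr C A B = u \<cdot> inr C A B"
    using sum_is_binary_coproduct[OF A B] unfolding is_binary_coproduct_def by blast
  with u copair_spec[OF f g] show ?thesis by blast
qed

lemma copair_eqD:
  assumes "copair C f g = copair C f' g'"
    and "f \<in> hom C A Y" "g \<in> hom C B Y" "f' \<in> hom C A Y" "g' \<in> hom C B Y"
  shows "f = f'" "g = g'"
  using assms(1) copair_inl[OF assms(2,3)] copair_inl[OF assms(4,5)]
    copair_inr[OF assms(2,3)] copair_inr[OF assms(4,5)] by simp_all

lemma Comp_copair: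
  assumes f: "f \<in> hom C A Y" and g: "g \<in> hom C B Y" and h: "h \<in> hom C Y Z"
  shows "h \<cdot> copair C f g = copair C (h \<cdot> f) (h \<cdot> g)"
proof -
  have A: "A \<in> Ob C" and B: "B \<in> Ob C" using hom_Ob f g by blast+
  have fg: "copair C f g \<in> hom C (sum_ob C A B) Y" using copair_in_hom f g .
  have "(h \<cdot> copair C f g) \<cdot> inl C A B = h \<cdot> f" "(h \<cdot> copair C f g) \<cdot> inr C A B = h \<cdot> g"
    using Comp_assoc[OF inl_in_hom[OF A B] fg h] Comp_assoc[OF inr_in_hom[OF A B] fg h]
    by (simp_all add: copair_inl[OF f g] copair_inr[OF f g])
  then show ?thesis using copair_unique[OF Comp_in_hom[OF fg h] A B] by simp
qed

lemma sum_ar_eq_copair: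
  assumes "f \<in> hom C X A" "g \<in> hom C Y B"
  shows "sum_ar C f g = copair C (inl C A B \<cdot> f) (inr C A B \<cdot> g)"
  using assms by (simp add: sum_ar_def hom_def)

lemma inl_Comp_in_hom:
    "f \<in> hom C X A \<Longrightarrow> B \<in> Ob C \<Longrightarrow> inl C A B \<cdot> f \<in> hom C X (sum_ob C A B)"
  and inr_Comp_in_hom:
    "g \<in> hom C Y B \<Longrightarrow> A \<in> Ob C \<Longrightarrow> inr C A B \<cdot> g \<in> hom C Y (sum_ob C A B)"
  using Comp_in_hom[OF _ inl_in_hom] Comp_in_hom[OF _ inr_in_hom] hom_Ob(2)[of f] hom_Ob(2)[of g]
  by simp_all

lemma sum_ar_in_hom:
  assumes "f \<in> hom C X A" "g \<in> hom C Y B"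
  shows "sum_ar C f g \<in> hom C (sum_ob C X Y) (sum_ob C A B)"
  unfolding sum_ar_eq_copair[OF assms]
  using copair_in_hom[OF inl_Comp_in_hom[OF assms(1) hom_Ob(2)[OF assms(2)]]
      inr_Comp_in_hom[OF assms(2) hom_Ob(2)[OF assms(1)]]] .

lemma copair_Comp_sum_ar:
  assumes f: "f \<in> hom C A Z" and g: "g \<in> hom C B Z" and h: "h \<in> hom C X A" and k: "k \<in> hom C Y B"
  shows "copair C f g \<cdot> sum_ar C h k = copair C (f \<cdot> h) (g \<cdot> k)"
proof -
  have A: "A \<in> Ob C" and B: "B \<in> Ob C" using hom_Ob f g by blast+
  have fg: "copair C f g \<in> hom C (sum_ob C A B) Z" using copair_in_hom f g .
  have "copair C f g \<cdot> (inl C A B \<cdot> h) = f \<cdot> h" "copair C f g \<cdot> (inr C A B \<cdot> k) = g \<cdot> k"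
    using Comp_assoc[OF h inl_in_hom[OF A B] fg] Comp_assoc[OF k inr_in_hom[OF A B] fg]
    by (simp_all add: copair_inl[OF f g] copair_inr[OF f g])
  then show ?thesis
    using Comp_copair[OF inl_Comp_in_hom[OF h B] inr_Comp_in_hom[OF k A] fg]
    by (simp add: sum_ar_eq_copair[OF h k])
qed

lemma sum_ar_Comp_sum_ar:
  assumes f: "f \<in> hom C A A'" and g: "g \<in> hom C B B'" and h: "h \<in> hom C X A" and k: "k \<in> hom C Y B"
  shows "sum_ar C f g \<cdot> sum_ar C h k = sum_ar C (f \<cdot> h) (g \<cdot> k)"
proof -
  have A': "A' \<in> Ob C" and B': "B' \<in> Ob C" using hom_Ob f g by blast+
  show ?thesis
    unfolding sum_ar_eq_copair[OF f g] sum_ar_eq_copair[OF Comp_in_hom[OF h f] Comp_in_hom[OF k g]]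
    using copair_Comp_sum_ar[OF inl_Comp_in_hom[OF f B'] inr_Comp_in_hom[OF g A'] h k]
      Comp_assoc[OF h f inl_in_hom[OF A' B']] Comp_assoc[OF k g inr_in_hom[OF A' B']]
    by simp
qed

end

section \<open>Extensive categories\<close>

lemma slice_Ob [simp]: "(X, f) \<in> Ob (slice C A) \<longleftrightarrow> f \<in> hom C X A"
  by (simp add: slice_def)

lemma slice_hom:
  "hom (slice C A) (X, f) (Y, g) =
    {((X, f), u, (Y, g)) | u. f \<in> hom C X A \<and> g \<in> hom C Y A \<and> u \<in> hom C X Y \<and> g \<cdot>\<^bsub>C\<^esub> u = f}"
  by (auto simp: slice_def hom_def)

lemma prod_cat_Ob [simp]: "Ob (prod_cat C D) = Ob C \<times> Ob D"
  by (simp add: prod_cat_def)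

lemma prod_cat_hom: "hom (prod_cat C D) (X, Y) (X', Y') = hom C X X' \<times> hom D Y Y'"
  by (auto simp: prod_cat_def hom_def)

locale extensive_category = category_with_sums +
  assumes coproduct_functor_equivalence: "A \<in> Ob C \<Longrightarrow> B \<in> Ob C \<Longrightarrow>
    is_equivalence (prod_cat (slice C A) (slice C B)) (slice C (sum_ob C A B)) (coproduct_functor C)"
begin

text \<open>Essential surjectivity of the coproduct functor at the object \<open>(W, h)\<close> of
  the slice over \<open>A + B\<close>. The isomorphism obtained there has \<open>\<phi>\<close> as
  its underlying arrow, and its being an arrow over \<open>A + B\<close> is the last
  equation.\<close>

lemma arrow_into_sum_decompose:
  assumes A: "A \<in> Ob C" and B: "B \<in> Ob C" and h: "h \<in> hom C W (sum_ob C A B)"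
  obtains W1 W2 h1 h2 \<phi> \<psi> where "h1 \<in> hom C W1 A" "h2 \<in> hom C W2 B"
    "\<phi> \<in> hom C (sum_ob C W1 W2) W" "\<psi> \<in> hom C W (sum_ob C W1 W2)"
    "\<phi> \<cdot> \<psi> = Id C W" "\<psi> \<cdot> \<phi> = Id C (sum_ob C W1 W2)" "h \<cdot> \<phi> = sum_ar C h1 h2"
proof -
  let ?S = "slice C (sum_ob C A B)"
  obtain W1 h1 W2 h2 e where h12: "h1 \<in> hom C W1 A" "h2 \<in> hom C W2 B"
    and e: "e \<in> hom ?S (sum_ob C W1 W2, sum_ar C h1 h2) (W, h)" and iso: "is_iso ?S e"
    using equivalence_essentially_surjective[OF coproduct_functor_equivalence[OF A B], of "(W, h)"] h
    by (auto simp: coproduct_functor_def sum_slice_ob_def)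
  have "category ?S"
    using coproduct_functor_equivalence[OF A B] by (simp add: is_equivalence_def is_functor_def)
  \<comment> \<open>The middle components of \<open>e\<close> and \<open>d\<close> are the required
    \<open>\<phi>\<close> and \<open>\<psi>\<close>; the slice identities become identities between
    these components.\<close>
  from category.is_isoE[OF this iso e] obtain d where
    "d \<in> hom ?S (W, h) (sum_ob C W1 W2, sum_ar C h1 h2)"
    "d \<cdot>\<^bsub>?S\<^esub> e = Id ?S (sum_ob C W1 W2, sum_ar C h1 h2)" "e \<cdot>\<^bsub>?S\<^esub> d = Id ?S (W, h)" .
  with e show thesis
    unfolding slice_hom by (auto simp: slice_def intro!: that[OF h12])
qed

text \<open>Fullness of the coproduct functor: the equation makes \<open>w\<close> an arrow of the
  slice over \<open>A + B\<close> between two objects in the image of the functor, so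
  \<open>w\<close> comes from a pair of arrows over \<open>A\<close> and \<open>B\<close>.\<close>

lemma arrow_over_sum_decompose:
  assumes f: "f \<in> hom C X A" and g: "g \<in> hom C Y B"
    and f': "f' \<in> hom C X' A" and g': "g' \<in> hom C Y' B"
    and w: "w \<in> hom C (sum_ob C X Y) (sum_ob C X' Y')"
    and eq: "sum_ar C f' g' \<cdot> w = sum_ar C f g"
  obtains u v where "u \<in> hom C X X'" "v \<in> hom C Y Y'" "w = sum_ar C u v" "f' \<cdot> u = f" "g' \<cdot> v = g"
proof -
  let ?P = "prod_cat (slice C A) (slice C B)"
  have AB: "A \<in> Ob C" "B \<in> Ob C" using hom_Ob f g by blast+
  have w': "((sum_ob C X Y, sum_ar C f g), w, (sum_ob C X' Y', sum_ar C f' g')) \<in>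
      hom (slice C (sum_ob C A B)) (FOb (coproduct_functor C) ((X, f), (Y, g)))
        (FOb (coproduct_functor C) ((X', f'), (Y', g')))"
    using w eq sum_ar_in_hom[OF f g] sum_ar_in_hom[OF f' g']
    by (simp add: coproduct_functor_def sum_slice_ob_def slice_hom)
  have "((X, f), (Y, g)) \<in> Ob ?P" "((X', f'), (Y', g')) \<in> Ob ?P" using f g f' g' by simp_all
  from equivalence_full[OF coproduct_functor_equivalence[OF AB] this w']
  obtain e where e: "e \<in> hom ?P ((X, f), (Y, g)) ((X', f'), (Y', g'))"
    "FAr (coproduct_functor C) e =
      ((sum_ob C X Y, sum_ar C f g), w, (sum_ob C X' Y', sum_ar C f' g'))"
    by blast
  from e(1) obtain u v where uv: "u \<in> hom C X X'" "v \<in> hom C Y Y'" "f' \<cdot> u = f" "g' \<cdot> v = g"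
    and "e = (((X, f), u, (X', f')), ((Y, g), v, (Y', g')))"
    unfolding prod_cat_hom slice_hom by blast
  with e(2) have "w = sum_ar C u v" by (simp add: coproduct_functor_def)
  from that[OF uv(1,2) this uv(3,4)] show thesis .
qed

text \<open>Faithfulness of the coproduct functor for the slices over \<open>S\<close> and
  \<open>T\<close>. The arrows \<open>f\<close> and \<open>g\<close> make \<open>A\<close> and
  \<open>B\<close> objects of these slices, and the equations with \<open>f\<close> and
  \<open>g\<close> ensure that \<open>u\<close>, \<open>u'\<close> and \<open>v\<close>,
  \<open>v'\<close> are parallel there.\<close>

lemma sum_ar_eqD:
  assumes u: "u \<in> hom C X A" "u' \<in> hom C X A" and v: "v \<in> hom C Y B" "v' \<in> hom C Y B"
    and f: "f \<in> hom C A S" "f \<cdot> u = f \<cdot> u'" and g: "g \<in> hom C B T" "g \<cdot> v = g \<cdot> v'"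
    and eq: "sum_ar C u v = sum_ar C u' v'"
  shows "u = u'" "v = v'"
proof -
  \<comment> \<open>The pair of slice arrows with underlying \<open>u\<close> and \<open>v\<close>;
    its sources are \<open>X\<close> and \<open>Y\<close> with the composites to \<open>S\<close>
    and \<open>T\<close> as structure arrows.\<close>
  define arr where "arr = (\<lambda>u v. (((X, f \<cdot> u), u, (A, f)), ((Y, g \<cdot> v), v, (B, g))))"
  have ST: "S \<in> Ob C" "T \<in> Ob C" using hom_Ob(2)[OF f(1)] hom_Ob(2)[OF g(1)] .
  have "arr u v = arr u' v'"
  proof (rule equivalence_faithful[OF coproduct_functor_equivalence[OF ST]])
    show "arr u v \<in> hom (prod_cat (slice C S) (slice C T)) ((X, f \<cdot> u), (Y, g \<cdot> v)) ((A, f), (B, g))"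
      "arr u' v' \<in> hom (prod_cat (slice C S) (slice C T)) ((X, f \<cdot> u), (Y, g \<cdot> v)) ((A, f), (B, g))"
      using u v f g Comp_in_hom[OF u(2) f(1)] Comp_in_hom[OF v(2) g(1)]
      by (simp_all add: arr_def prod_cat_hom slice_hom)
    show "FAr (coproduct_functor C) (arr u v) = FAr (coproduct_functor C) (arr u' v')"
      using f g eq by (simp add: arr_def coproduct_functor_def sum_slice_ob_def)
  qed
  then show "u = u'" "v = v'" by (simp_all add: arr_def)
qed

end

section \<open>Pullbacks of sums\<close>

lemma comm_squareE:
  assumes "comm_square C t l r b"
  obtains P X Y Z where "t \<in> hom C P X" "l \<in> hom C P Y" "r \<in> hom C X Z" "b \<in> hom C Y Z"
    "r \<cdot>\<^bsub>C\<^esub> t = b \<cdot>\<^bsub>C\<^esub> l"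
  using assms unfolding comm_square_def hom_def by simp

lemma comm_squareI:
  assumes "t \<in> hom C P X" "l \<in> hom C P Y" "r \<in> hom C X Z" "b \<in> hom C Y Z"
    "r \<cdot>\<^bsub>C\<^esub> t = b \<cdot>\<^bsub>C\<^esub> l"
  shows "comm_square C t l r b"
  using assms unfolding comm_square_def hom_def by simp

lemma pullback_square_comm: "pullback_square C t l r b \<Longrightarrow> comm_square C t l r b"
  by (simp add: pullback_square_def)

lemma pullback_squareD:
  assumes "pullback_square C t l r b"
    and "t \<in> hom C P X" "r \<in> hom C X Z" "b \<in> hom C Y Z"
    and f: "f \<in> hom C W X" and g: "g \<in> hom C W Y" "r \<cdot>\<^bsub>C\<^esub> f = b \<cdot>\<^bsub>C\<^esub> g"
  shows "\<exists>!u. u \<in> hom C W P \<and> t \<cdot>\<^bsub>C\<^esub> u = f \<and> l \<cdot>\<^bsub>C\<^esub> u = g"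
proof -
  have "comm_square C f g r b" by (rule comm_squareI[OF f g(1) assms(3,4) g(2)])
  then have "\<exists>!u. u \<in> hom C (Dom C f) (Dom C t) \<and> t \<cdot>\<^bsub>C\<^esub> u = f \<and> l \<cdot>\<^bsub>C\<^esub> u = g"
    using assms(1) unfolding pullback_square_def by blast
  moreover have "Dom C f = W" "Dom C t = P" using f assms(2) by (auto simp: hom_def)
  ultimately show ?thesis by simp
qed

context category
begin

text \<open>It suffices to check the universal property on an isomorphic copy of the apex of each cone.\<close>

lemma pullback_squareI_up_to_iso:
  assumes t: "t \<in> hom C P X" and l: "l \<in> hom C P Y" and r: "r \<in> hom C X Z" and b: "b \<in> hom C Y Z"
    and comm: "r \<cdot> t = b \<cdot> l"
    and univ: "\<And>W f g. f \<in> hom C W X \<Longrightarrow> g \<in> hom C W Y \<Longrightarrow> r \<cdot> f = b \<cdot> g \<Longrightarrow>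
      \<exists>V \<phi> \<psi>. \<phi> \<in> hom C V W \<and> \<psi> \<in> hom C W V \<and> \<phi> \<cdot> \<psi> = Id C W \<and> \<psi> \<cdot> \<phi> = Id C V \<and>
        (\<exists>!v. v \<in> hom C V P \<and> t \<cdot> v = f \<cdot> \<phi> \<and> l \<cdot> v = g \<cdot> \<phi>)"
  shows "pullback_square C t l r b"
  unfolding pullback_square_def
proof (intro conjI allI impI)
  show "comm_square C t l r b" by (rule comm_squareI[OF t l r b comm])
next
  fix f g
  assume "comm_square C f g r b"
  then have "f \<in> hom C (Dom C f) X" "g \<in> hom C (Dom C f) Y" "r \<cdot> f = b \<cdot> g"
    using r b unfolding comm_square_def hom_def by auto
  then obtain W where W: "W = Dom C f" and f: "f \<in> hom C W X" and g: "g \<in> hom C W Y"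
    and fg: "r \<cdot> f = b \<cdot> g" by blast
  from univ[OF f g fg] obtain V \<phi> \<psi> where \<phi>: "\<phi> \<in> hom C V W" and \<psi>: "\<psi> \<in> hom C W V"
    and \<phi>\<psi>: "\<phi> \<cdot> \<psi> = Id C W" and \<psi>\<phi>: "\<psi> \<cdot> \<phi> = Id C V"
    and ex1: "\<exists>!v. v \<in> hom C V P \<and> t \<cdot> v = f \<cdot> \<phi> \<and> l \<cdot> v = g \<cdot> \<phi>" by blast
  \<comment> \<open>Precomposition with \<open>\<psi>\<close> undoes precomposition with
    \<open>\<phi>\<close>; this carries both existence and uniqueness of the factorization from
    \<open>V\<close> back to \<open>W\<close>.\<close>
  have cancel: "(k \<cdot> \<phi>) \<cdot> \<psi> = k" if "k \<in> hom C W T" for k T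
    using Comp_assoc[OF \<psi> \<phi> that] Comp_Id[OF that] \<phi>\<psi> by simp
  obtain v where v: "v \<in> hom C V P" "t \<cdot> v = f \<cdot> \<phi>" "l \<cdot> v = g \<cdot> \<phi>"
    using ex1 by blast
  have "\<exists>!u. u \<in> hom C W P \<and> t \<cdot> u = f \<and> l \<cdot> u = g"
  proof (rule ex1I)
    show "v \<cdot> \<psi> \<in> hom C W P \<and> t \<cdot> (v \<cdot> \<psi>) = f \<and> l \<cdot> (v \<cdot> \<psi>) = g"
      using Comp_in_hom[OF \<psi> v(1)] Comp_assoc[OF \<psi> v(1) t] Comp_assoc[OF \<psi> v(1) l]
        v(2,3) cancel[OF f] cancel[OF g] by simp
  next
    fix u
    assume u: "u \<in> hom C W P \<and> t \<cdot> u = f \<and> l \<cdot> u = g"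
    then have "u \<cdot> \<phi> \<in> hom C V P" "t \<cdot> (u \<cdot> \<phi>) = f \<cdot> \<phi>" "l \<cdot> (u \<cdot> \<phi>) = g \<cdot> \<phi>"
      using Comp_in_hom[OF \<phi>] Comp_assoc[OF \<phi> _ t] Comp_assoc[OF \<phi> _ l] by auto
    then have "u \<cdot> \<phi> = v" using ex1 v by blast
    then show "u = v \<cdot> \<psi>" using cancel[of u P] u by simp
  qed
  then show "\<exists>!u. u \<in> hom C (Dom C f) (Dom C t) \<and> t \<cdot> u = f \<and> l \<cdot> u = g"
    using W t by (simp add: hom_def)
qed

text \<open>An identity is the coequalizer of itself with itself, each \<open>q\<close> factoring
  through it as \<open>q\<close>.\<close>

lemma regular_epi_Id: "A \<in> Ob C \<Longrightarrow> regular_epi C (Id C A)"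
  unfolding regular_epi_def is_coequalizer_def
  by (intro exI[of _ "Id C A"] exI[of _ A]) (auto simp: Id_in_hom Comp_Id)

text \<open>The square serves as its own pullback, so the induced arrow is an identity, which is a
  regular epimorphism.\<close>

lemma feeble_pullback_square_if_pullback:
  assumes "pullback_square C t l r b"
  shows "feeble_pullback_square C t l r b"
proof -
  note comm = pullback_square_comm[OF assms]
  obtain P X Y Z where t: "t \<in> hom C P X" and l: "l \<in> hom C P Y"
    using comm by (rule comm_squareE)
  have "P \<in> Ob C" "Dom C t = P" using hom_Ob t by (auto simp: hom_def)
  then show ?thesis
    unfolding feeble_pullback_square_def
    using assms comm Comp_Id[OF t] Comp_Id[OF l]
    by (intro conjI exI[of _ t] exI[of _ l] exI[of _ "Id C P"]) (simp_all add: Id_in_hom regular_epi_Id)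
qed

text \<open>The kernel pair of a monomorphism is trivial: the legs of a cone agree, and their common
  value is the only factorization.\<close>

lemma pullback_square_mono_self:
  assumes m: "m \<in> hom C S A" and mono: "mono_ar C m"
  shows "pullback_square C (Id C S) (Id C S) m m"
proof -
  have Id: "Id C S \<in> hom C S S" using Id_in_hom hom_Ob(1)[OF m] .
  show ?thesis
  proof (rule pullback_squareI_up_to_iso[OF Id Id m m refl])
    fix W f g
    assume f: "f \<in> hom C W S" and g: "g \<in> hom C W S" and eq: "m \<cdot> f = m \<cdot> g"
    have W: "W \<in> Ob C" and "f = g"
      using hom_Ob(1)[OF f] mono m f g eq unfolding mono_ar_def hom_def by auto
    moreover have "\<exists>!v. v \<in> hom C W S \<and> Id C S \<cdot> v = g \<cdot> Id C W \<and> Id C S \<cdot> v = g \<cdot> Id C W"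
      using Comp_Id[OF g] g by (auto simp: Id_Comp)
    \<comment> \<open>The apex needs no change: take \<open>V = W\<close> and identities for
      \<open>\<phi>\<close> and \<open>\<psi>\<close>.\<close>
    ultimately show "\<exists>V \<phi> \<psi>. \<phi> \<in> hom C V W \<and> \<psi> \<in> hom C W V \<and> \<phi> \<cdot> \<psi> = Id C W \<and>
        \<psi> \<cdot> \<phi> = Id C V \<and> (\<exists>!v. v \<in> hom C V S \<and> Id C S \<cdot> v = f \<cdot> \<phi> \<and> Id C S \<cdot> v = g \<cdot> \<phi>)"
      using Id_in_hom[OF W] Comp_Id[OF Id_in_hom[OF W]] by blast
  qed
qed

text \<open>Commutativity forces \<open>f\<close> to be \<open>p \<cdot> g\<close>, so a cone is the
  same thing as its leg \<open>g\<close>, which is also the factorization.\<close>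

lemma pullback_square_Id:
  assumes p: "p \<in> hom C E B"
  shows "pullback_square C p (Id C E) (Id C B) p"
proof (rule pullback_squareI_up_to_iso[OF p Id_in_hom[OF hom_Ob(1)[OF p]]
      Id_in_hom[OF hom_Ob(2)[OF p]] p])
  show "Id C B \<cdot> p = p \<cdot> Id C E" using Comp_Id[OF p] Id_Comp[OF p] by simp
  fix W f g
  assume f: "f \<in> hom C W B" and g: "g \<in> hom C W E" and eq: "Id C B \<cdot> f = p \<cdot> g"
  have W: "W \<in> Ob C" using hom_Ob f by blast
  have f_eq: "f \<cdot> Id C W = p \<cdot> g" using Comp_Id[OF f] Id_Comp[OF f] eq by simp
  have "\<exists>!v. v \<in> hom C W E \<and> p \<cdot> v = f \<cdot> Id C W \<and> Id C E \<cdot> v = g \<cdot> Id C W"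
    unfolding f_eq Comp_Id[OF g] by (rule ex1I[of _ g]) (auto simp: g Id_Comp[of _ W E])
  then show "\<exists>V \<phi> \<psi>. \<phi> \<in> hom C V W \<and> \<psi> \<in> hom C W V \<and> \<phi> \<cdot> \<psi> = Id C W \<and>
      \<psi> \<cdot> \<phi> = Id C V \<and> (\<exists>!v. v \<in> hom C V E \<and> p \<cdot> v = f \<cdot> \<phi> \<and> Id C E \<cdot> v = g \<cdot> \<phi>)"
    using Id_in_hom[OF W] Comp_Id[OF Id_in_hom[OF W]] by blast
qed

end

section \<open>Pullback squares under sums and copairing\<close>

context extensive_category
begin

lemma pullback_square_sum:
  assumes p: "pullback_square C t l r b" and p': "pullback_square C t' l' r' b'"
  shows "pullback_square C (sum_ar C t t') (sum_ar C l l') (sum_ar C r r') (sum_ar C b b')"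
proof -
  obtain P X Y Z where t: "t \<in> hom C P X" and l: "l \<in> hom C P Y" and r: "r \<in> hom C X Z"
    and b: "b \<in> hom C Y Z" and comm: "r \<cdot> t = b \<cdot> l"
    by (rule comm_squareE[OF pullback_square_comm[OF p]])
  obtain P' X' Y' Z' where t': "t' \<in> hom C P' X'" and l': "l' \<in> hom C P' Y'" and r': "r' \<in> hom C X' Z'"
    and b': "b' \<in> hom C Y' Z'" and comm': "r' \<cdot> t' = b' \<cdot> l'"
    by (rule comm_squareE[OF pullback_square_comm[OF p']])
  note T = sum_ar_in_hom[OF t t'] and L = sum_ar_in_hom[OF l l']
    and R = sum_ar_in_hom[OF r r'] and B = sum_ar_in_hom[OF b b']
  note RT = sum_ar_Comp_sum_ar[OF r r' t t']
  show ?thesis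
  proof (rule pullback_squareI_up_to_iso[OF T L R B])
    show "sum_ar C r r' \<cdot> sum_ar C t t' = sum_ar C b b' \<cdot> sum_ar C l l'"
      using RT sum_ar_Comp_sum_ar[OF b b' l l'] comm comm' by simp
    fix W f g
    assume f: "f \<in> hom C W (sum_ob C X X')" and g: "g \<in> hom C W (sum_ob C Y Y')"
      and fg: "sum_ar C r r' \<cdot> f = sum_ar C b b' \<cdot> g"
    \<comment> \<open>The diagonal of the cone is split, rather than \<open>f\<close> and
      \<open>g\<close> separately, so that both legs decompose along the same \<open>W1\<close> and
      \<open>W2\<close>.\<close>
    obtain W1 W2 h1 h2 \<phi> \<psi> where h1: "h1 \<in> hom C W1 Z" and h2: "h2 \<in> hom C W2 Z'"
      and \<phi>: "\<phi> \<in> hom C (sum_ob C W1 W2) W" and iso: "\<psi> \<in> hom C W (sum_ob C W1 W2)"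
        "\<phi> \<cdot> \<psi> = Id C W" "\<psi> \<cdot> \<phi> = Id C (sum_ob C W1 W2)"
      and h: "(sum_ar C r r' \<cdot> f) \<cdot> \<phi> = sum_ar C h1 h2"
      by (rule arrow_into_sum_decompose[OF hom_Ob(2)[OF r] hom_Ob(2)[OF r'] Comp_in_hom[OF f R]])
    have f\<phi>: "sum_ar C r r' \<cdot> (f \<cdot> \<phi>) = sum_ar C h1 h2" using Comp_assoc[OF \<phi> f R] h by simp
    obtain f1 f2 where f1: "f1 \<in> hom C W1 X" and f2: "f2 \<in> hom C W2 X'"
      and f12: "f \<cdot> \<phi> = sum_ar C f1 f2" and rf: "r \<cdot> f1 = h1" "r' \<cdot> f2 = h2"
      by (rule arrow_over_sum_decompose[OF h1 h2 r r' Comp_in_hom[OF \<phi> f] f\<phi>])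
    have g\<phi>: "sum_ar C b b' \<cdot> (g \<cdot> \<phi>) = sum_ar C h1 h2" using Comp_assoc[OF \<phi> g B] h fg by simp
    obtain g1 g2 where g1: "g1 \<in> hom C W1 Y" and g2: "g2 \<in> hom C W2 Y'"
      and g12: "g \<cdot> \<phi> = sum_ar C g1 g2" and bg: "b \<cdot> g1 = h1" "b' \<cdot> g2 = h2"
      by (rule arrow_over_sum_decompose[OF h1 h2 b b' Comp_in_hom[OF \<phi> g] g\<phi>])
    \<comment> \<open>Both \<open>f1\<close> and \<open>g1\<close> lie over \<open>h1\<close>, so
      they form a cone over the first square; likewise \<open>f2\<close> and \<open>g2\<close> over
      the second.\<close>
    have ex1: "\<exists>!u. u \<in> hom C W1 P \<and> t \<cdot> u = f1 \<and> l \<cdot> u = g1"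
      by (rule pullback_squareD[OF p t r b f1 g1]) (simp add: rf bg)
    have ex2: "\<exists>!u. u \<in> hom C W2 P' \<and> t' \<cdot> u = f2 \<and> l' \<cdot> u = g2"
      by (rule pullback_squareD[OF p' t' r' b' f2 g2]) (simp add: rf bg)
    obtain u1 where u1: "u1 \<in> hom C W1 P" "t \<cdot> u1 = f1" "l \<cdot> u1 = g1" using ex1 by blast
    obtain u2 where u2: "u2 \<in> hom C W2 P'" "t' \<cdot> u2 = f2" "l' \<cdot> u2 = g2" using ex2 by blast
    have "\<exists>!v. v \<in> hom C (sum_ob C W1 W2) (sum_ob C P P') \<and>
      sum_ar C t t' \<cdot> v = f \<cdot> \<phi> \<and> sum_ar C l l' \<cdot> v = g \<cdot> \<phi>"
    proof (rule ex1I)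
      show "sum_ar C u1 u2 \<in> hom C (sum_ob C W1 W2) (sum_ob C P P') \<and>
        sum_ar C t t' \<cdot> sum_ar C u1 u2 = f \<cdot> \<phi> \<and> sum_ar C l l' \<cdot> sum_ar C u1 u2 = g \<cdot> \<phi>"
        using sum_ar_in_hom[OF u1(1) u2(1)] sum_ar_Comp_sum_ar[OF t t' u1(1) u2(1)]
          sum_ar_Comp_sum_ar[OF l l' u1(1) u2(1)] u1 u2 f12 g12 by simp
    next
      fix v
      assume "v \<in> hom C (sum_ob C W1 W2) (sum_ob C P P') \<and>
        sum_ar C t t' \<cdot> v = f \<cdot> \<phi> \<and> sum_ar C l l' \<cdot> v = g \<cdot> \<phi>"
      then have v: "v \<in> hom C (sum_ob C W1 W2) (sum_ob C P P')"
        and tv: "sum_ar C t t' \<cdot> v = sum_ar C f1 f2" and lv: "sum_ar C l l' \<cdot> v = sum_ar C g1 g2"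
        using f12 g12 by auto
      \<comment> \<open>To see that \<open>v\<close> is itself a sum, it is viewed over
        \<open>Z + Z'\<close> through the diagonal of the summed square.\<close>
      have "sum_ar C (r \<cdot> t) (r' \<cdot> t') \<cdot> v = sum_ar C h1 h2"
        using Comp_assoc[OF v T R] RT tv sum_ar_Comp_sum_ar[OF r r' f1 f2] rf by simp
      from h1 h2 Comp_in_hom[OF t r] Comp_in_hom[OF t' r'] v this
      obtain v1 v2 where v1: "v1 \<in> hom C W1 P" and v2: "v2 \<in> hom C W2 P'"
        and v12: "v = sum_ar C v1 v2" and rtv: "(r \<cdot> t) \<cdot> v1 = h1" "(r' \<cdot> t') \<cdot> v2 = h2"
        by (rule arrow_over_sum_decompose)
      \<comment> \<open>Cancelling sums by faithfulness requires arrows that already agree over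
        \<open>Z\<close> or \<open>Z'\<close>; these equations supply that, since all composites
        equal \<open>h1\<close> or \<open>h2\<close>.\<close>
      have r1: "r \<cdot> (t \<cdot> v1) = r \<cdot> f1" and r2: "r' \<cdot> (t' \<cdot> v2) = r' \<cdot> f2"
        using Comp_assoc[OF v1 t r] Comp_assoc[OF v2 t' r'] rtv rf by simp_all
      have b1: "b \<cdot> (l \<cdot> v1) = b \<cdot> g1" and b2: "b' \<cdot> (l' \<cdot> v2) = b' \<cdot> g2"
        using Comp_assoc[OF v1 l b] Comp_assoc[OF v2 l' b'] rtv bg comm comm'
        by simp_all
      have t12: "sum_ar C (t \<cdot> v1) (t' \<cdot> v2) = sum_ar C f1 f2"
        using sum_ar_Comp_sum_ar[OF t t' v1 v2] tv v12 by simp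
      have l12: "sum_ar C (l \<cdot> v1) (l' \<cdot> v2) = sum_ar C g1 g2"
        using sum_ar_Comp_sum_ar[OF l l' v1 v2] lv v12 by simp
      note tf = sum_ar_eqD[OF Comp_in_hom[OF v1 t] f1 Comp_in_hom[OF v2 t'] f2 r r1 r' r2 t12]
      note lg = sum_ar_eqD[OF Comp_in_hom[OF v1 l] g1 Comp_in_hom[OF v2 l'] g2 b b1 b' b2 l12]
      have "v1 = u1" using ex1 u1 v1 tf(1) lg(1) by blast
      moreover have "v2 = u2" using ex2 u2 v2 tf(2) lg(2) by blast
      ultimately show "v = sum_ar C u1 u2" using v12 by simp
    qed
    then show "\<exists>V \<phi> \<psi>. \<phi> \<in> hom C V W \<and> \<psi> \<in> hom C W V \<and> \<phi> \<cdot> \<psi> = Id C W \<and> \<psi> \<cdot> \<phi> = Id C V \<and>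
      (\<exists>!v. v \<in> hom C V (sum_ob C P P') \<and> sum_ar C t t' \<cdot> v = f \<cdot> \<phi> \<and> sum_ar C l l' \<cdot> v = g \<cdot> \<phi>)"
      using \<phi> iso by blast
  qed
qed

text \<open>Pulling back along a fixed \<open>b\<close> preserves sums. Only the leg
  \<open>f\<close> goes into a sum and needs extensivity to be split; the leg \<open>g\<close> is
  then restricted along the injections of \<open>W1 + W2\<close>.\<close>

lemma pullback_square_copair:
  assumes p: "pullback_square C t l r b" and p': "pullback_square C t' l' r' b"
  shows "pullback_square C (sum_ar C t t') (copair C l l') (copair C r r') b"
proof -
  obtain P X Y Z where t: "t \<in> hom C P X" and l: "l \<in> hom C P Y" and r: "r \<in> hom C X Z"
    and b: "b \<in> hom C Y Z" and comm: "r \<cdot> t = b \<cdot> l"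
    by (rule comm_squareE[OF pullback_square_comm[OF p]])
  obtain P' X' Y' Z' where t': "t' \<in> hom C P' X'" and "l' \<in> hom C P' Y'" "r' \<in> hom C X' Z'"
    and "b \<in> hom C Y' Z'" and comm': "r' \<cdot> t' = b \<cdot> l'"
    by (rule comm_squareE[OF pullback_square_comm[OF p']])
  \<comment> \<open>Sharing the bottom side \<open>b\<close> identifies \<open>Y'\<close> with
    \<open>Y\<close> and \<open>Z'\<close> with \<open>Z\<close>.\<close>
  with b have l': "l' \<in> hom C P' Y" and r': "r' \<in> hom C X' Z" by (simp_all add: hom_def)
  note T = sum_ar_in_hom[OF t t'] and L = copair_in_hom[OF l l'] and R = copair_in_hom[OF r r']
  have X: "X \<in> Ob C" "X' \<in> Ob C" using hom_Ob t t' by blast+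
  show ?thesis
  proof (rule pullback_squareI_up_to_iso[OF T L R b])
    show "copair C r r' \<cdot> sum_ar C t t' = b \<cdot> copair C l l'"
      using copair_Comp_sum_ar[OF r r' t t'] Comp_copair[OF l l' b] comm comm' by simp
    fix W f g
    assume f: "f \<in> hom C W (sum_ob C X X')" and g: "g \<in> hom C W Y" and fg: "copair C r r' \<cdot> f = b \<cdot> g"
    obtain W1 W2 f1 f2 \<phi> \<psi> where f1: "f1 \<in> hom C W1 X" and f2: "f2 \<in> hom C W2 X'"
      and \<phi>: "\<phi> \<in> hom C (sum_ob C W1 W2) W" and iso: "\<psi> \<in> hom C W (sum_ob C W1 W2)"
        "\<phi> \<cdot> \<psi> = Id C W" "\<psi> \<cdot> \<phi> = Id C (sum_ob C W1 W2)"
      and f12: "f \<cdot> \<phi> = sum_ar C f1 f2"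
      by (rule arrow_into_sum_decompose[OF X f])
    have W: "W1 \<in> Ob C" "W2 \<in> Ob C" using hom_Ob f1 f2 by blast+
    note g\<phi> = Comp_in_hom[OF \<phi> g]
    define g1 where "g1 = (g \<cdot> \<phi>) \<cdot> inl C W1 W2"
    define g2 where "g2 = (g \<cdot> \<phi>) \<cdot> inr C W1 W2"
    have g1: "g1 \<in> hom C W1 Y" and g2: "g2 \<in> hom C W2 Y"
      unfolding g1_def g2_def
      using Comp_in_hom[OF inl_in_hom[OF W] g\<phi>] Comp_in_hom[OF inr_in_hom[OF W] g\<phi>] .
    have g12: "g \<cdot> \<phi> = copair C g1 g2"
      unfolding g1_def g2_def using copair_unique[OF g\<phi> W] .
    have "copair C (r \<cdot> f1) (r' \<cdot> f2) = copair C r r' \<cdot> (f \<cdot> \<phi>)"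
      unfolding f12 using copair_Comp_sum_ar[OF r r' f1 f2] by simp
    also have "\<dots> = b \<cdot> (g \<cdot> \<phi>)"
      using Comp_assoc[OF \<phi> f R] Comp_assoc[OF \<phi> g b] fg by simp
    also have "\<dots> = copair C (b \<cdot> g1) (b \<cdot> g2)"
      unfolding g12 using Comp_copair[OF g1 g2 b] .
    finally have "copair C (r \<cdot> f1) (r' \<cdot> f2) = copair C (b \<cdot> g1) (b \<cdot> g2)" .
    \<comment> \<open>Restricting to the two injections turns the one commuting condition into a
      cone over each given square.\<close>
    note rb = copair_eqD[OF this Comp_in_hom[OF f1 r] Comp_in_hom[OF f2 r']
        Comp_in_hom[OF g1 b] Comp_in_hom[OF g2 b]]
    note ex1 = pullback_squareD[OF p t r b f1 g1 rb(1)]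
      and ex2 = pullback_squareD[OF p' t' r' b f2 g2 rb(2)]
    obtain u1 where u1: "u1 \<in> hom C W1 P" "t \<cdot> u1 = f1" "l \<cdot> u1 = g1" using ex1 by blast
    obtain u2 where u2: "u2 \<in> hom C W2 P'" "t' \<cdot> u2 = f2" "l' \<cdot> u2 = g2" using ex2 by blast
    have "\<exists>!v. v \<in> hom C (sum_ob C W1 W2) (sum_ob C P P') \<and>
      sum_ar C t t' \<cdot> v = f \<cdot> \<phi> \<and> copair C l l' \<cdot> v = g \<cdot> \<phi>"
    proof (rule ex1I)
      show "sum_ar C u1 u2 \<in> hom C (sum_ob C W1 W2) (sum_ob C P P') \<and>
        sum_ar C t t' \<cdot> sum_ar C u1 u2 = f \<cdot> \<phi> \<and> copair C l l' \<cdot> sum_ar C u1 u2 = g \<cdot> \<phi>"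
        using sum_ar_in_hom[OF u1(1) u2(1)] sum_ar_Comp_sum_ar[OF t t' u1(1) u2(1)]
          copair_Comp_sum_ar[OF l l' u1(1) u2(1)] u1 u2 f12 g12 by simp
    next
      fix v
      assume "v \<in> hom C (sum_ob C W1 W2) (sum_ob C P P') \<and>
        sum_ar C t t' \<cdot> v = f \<cdot> \<phi> \<and> copair C l l' \<cdot> v = g \<cdot> \<phi>"
      then have v: "v \<in> hom C (sum_ob C W1 W2) (sum_ob C P P')"
        and tv: "sum_ar C t t' \<cdot> v = sum_ar C f1 f2" and lv: "copair C l l' \<cdot> v = copair C g1 g2"
        by (simp_all add: f12 g12)
      \<comment> \<open>Here \<open>v\<close> is viewed over \<open>X + X'\<close> through
        \<open>sum_ar C t t'\<close>, so fullness gives its splitting and the equations for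
        \<open>t\<close> and \<open>t'\<close> at once; those for \<open>l\<close> and
        \<open>l'\<close> follow by restriction to the injections.\<close>
      from f1 f2 t t' v tv obtain v1 v2 where v1: "v1 \<in> hom C W1 P" and v2: "v2 \<in> hom C W2 P'"
        and v12: "v = sum_ar C v1 v2" and tf: "t \<cdot> v1 = f1" "t' \<cdot> v2 = f2"
        by (rule arrow_over_sum_decompose)
      have "copair C (l \<cdot> v1) (l' \<cdot> v2) = copair C g1 g2"
        using copair_Comp_sum_ar[OF l l' v1 v2] lv v12 by simp
      note lg = copair_eqD[OF this Comp_in_hom[OF v1 l] Comp_in_hom[OF v2 l'] g1 g2]
      have "v1 = u1" using ex1 u1 v1 tf(1) lg(1) by blast
      moreover have "v2 = u2" using ex2 u2 v2 tf(2) lg(2) by blast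
      ultimately show "v = sum_ar C u1 u2" using v12 by simp
    qed
    then show "\<exists>V \<phi> \<psi>. \<phi> \<in> hom C V W \<and> \<psi> \<in> hom C W V \<and> \<phi> \<cdot> \<psi> = Id C W \<and> \<psi> \<cdot> \<phi> = Id C V \<and>
      (\<exists>!v. v \<in> hom C V (sum_ob C P P') \<and> sum_ar C t t' \<cdot> v = f \<cdot> \<phi> \<and> copair C l l' \<cdot> v = g \<cdot> \<phi>)"
      using \<phi> iso by blast
  qed
qed

end

theorem proposition2p5:
  fixes C :: "('o, 'm) cat"
  assumes "lextensive C"
  shows "condition_P C"
proof -
  have C: "category C" "has_finite_limits C" "has_finite_coproducts C"
    using assms by (simp_all add: lextensive_def extensive_def)
  interpret extensive_category C
    using assms unfolding lextensive_def extensive_def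
    by (intro extensive_category.intro category_with_sums.intro category_with_sums_axioms.intro
        extensive_category_axioms.intro) auto
  \<comment> \<open>The first summand is the square with sides \<open>m\<close>,
    \<open>Id C S\<close>, \<open>Id C A\<close>, \<open>m\<close>; the second is the kernel pair
    square of \<open>m\<close>. Both have bottom side \<open>m\<close>, as copairing
    requires.\<close>
  have c: "pullback_square C (sum_ar C m (Id C S)) (copair C (Id C S) (Id C S)) (copair C (Id C A) m) m"
    if "m \<in> hom C S A" "mono_ar C m" for m S A
    using pullback_square_copair pullback_square_Id pullback_square_mono_self that by blast
  \<comment> \<open>Both summands are the square with top and bottom \<open>p\<close> and identities
    as vertical sides.\<close>
  have d: "feeble_pullback_square C (sum_ar C p p) (copair C (Id C E) (Id C E))
      (copair C (Id C B) (Id C B)) p" if "p \<in> hom C E B" for p E B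
    using feeble_pullback_square_if_pullback pullback_square_copair pullback_square_Id that by blast
  show ?thesis
    unfolding condition_P_def using C pullback_square_sum c d by blast
qed

end
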